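(* Let $d_w>2$ and let $(X,d,\mu)$ be a compact metric measure space with $\mu$ a positive doubling Radon measure, and assume the 2-Poincaré inequality with Korevaar–Schoen energies (P) stated in the context. Then any sequence $\{f_n\}_{n\ge1}\subset KS^{d_w/2,2}(X)$ such that $$\sup_{n\ge1}\Big(\|f_n\|_{L^2(X,\mu)}+\liminf_{r\to0^+}E_{d_w/2,X}(f_n,r)\Big)<\infty$$ contains a subsequence that converges in $L^2(X,\mu)$.
   Context: $B(x,r)$ denotes the open ball. Positive and doubling: there is $C>0$ with $0<\mu(B(x,2r))\le C\mu(B(x,r))<\infty$ for all $x\in X$, $r>0$. For a Borel set $U\subseteq X$, $r>0$ and $f\in L^2(X,\mu)$, $$E_{d_w/2,U}(f,r):=\int_U\frac{1}{\mu(B(x,r))}\int_{B(x,r)}\frac{|f(y)-f(x)|^2}{r^{d_w}}\,d\mu(y)\,d\mu(x),$$ and $KS^{d_w/2,2}(X)=\{f\in L^2(X,\mu):\limsup_{r\to0^+}E_{d_w/2,X}(f,r)<+\infty\}$. (P) There are $C>0$, $\lambda\ge1$ such that for all $f\in KS^{d_w/2,2}(X)$, $x\in X$, $R>0$: $\int_{B(x,R)}|f(y)-f_{B(x,R)}|^2d\mu(y)\le CR^{d_w}\liminf_{r\to0^+}E_{d_w/2,B(x,\lambda R)}(f,r)$, where $f_{B(x,R)}=\frac{1}{\mu(B(x,R))}\int_{B(x,R)}f\,d\mu$. *)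

theory Defs
  imports "HOL-Analysis.Analysis"
begin

text \<open>
  The metric space is a type of class \<open>metric_space\<close>; the measure lives on its Borel
  sigma-algebra. Elements of \<open>L\<^sup>2\<close> are represented by Borel measurable real functions; all
  notions below are invariant under modification on null sets. Energies take
  values in \<open>ennreal\<close>, so that no convergence has to be presupposed.
\<close>

definition radon_measure :: "'a::metric_space measure \<Rightarrow> bool" where
  "radon_measure M \<longleftrightarrow>
     sets M = sets borel \<and>
     (\<forall>K. compact K \<longrightarrow> emeasure M K < \<infinity>) \<and>
     (\<forall>A\<in>sets borel. emeasure M A = (INF U\<in>{U. open U \<and> A \<subseteq> U}. emeasure M U)) \<and>
     (\<forall>U. open U \<longrightarrow> emeasure M U = (SUP K\<in>{K. compact K \<and> K \<subseteq> U}. emeasure M K))"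

definition positive_doubling :: "'a::metric_space measure \<Rightarrow> bool" where
  "positive_doubling M \<longleftrightarrow>
     (\<exists>C::real. C > 0 \<and> (\<forall>x r. r > 0 \<longrightarrow>
        0 < emeasure M (ball x (2 * r)) \<and>
        emeasure M (ball x (2 * r)) \<le> ennreal C * emeasure M (ball x r) \<and>
        ennreal C * emeasure M (ball x r) < \<infinity>))"

definition L2_space :: "'a measure \<Rightarrow> ('a \<Rightarrow> real) set" where
  "L2_space M = {f \<in> borel_measurable M. integrable M (\<lambda>x. (f x)\<^sup>2)}"

definition L2_norm :: "'a measure \<Rightarrow> ('a \<Rightarrow> real) \<Rightarrow> real" where
  "L2_norm M f = sqrt (LINT x|M. (f x)\<^sup>2)"

definition KS_energy ::
  "'a::metric_space measure \<Rightarrow> real \<Rightarrow> 'a set \<Rightarrow> ('a \<Rightarrow> real) \<Rightarrow> real \<Rightarrow> ennreal" where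
  "KS_energy M dw U f r =
     (\<integral>\<^sup>+x\<in>U. (1 / emeasure M (ball x r) *
        (\<integral>\<^sup>+y\<in>ball x r. ennreal (\<bar>f y - f x\<bar>\<^sup>2 / r powr dw) \<partial>M)) \<partial>M)"

definition KS_space :: "'a::metric_space measure \<Rightarrow> real \<Rightarrow> ('a \<Rightarrow> real) set" where
  "KS_space M dw =
     {f \<in> L2_space M. Limsup (at_right 0) (KS_energy M dw UNIV f) < \<infinity>}"

definition ball_average :: "'a::metric_space measure \<Rightarrow> ('a \<Rightarrow> real) \<Rightarrow> 'a \<Rightarrow> real \<Rightarrow> real" where
  "ball_average M f x R = 1 / measure M (ball x R) * (LINT y:ball x R|M. f y)"

definition KS_poincare :: "'a::metric_space measure \<Rightarrow> real \<Rightarrow> bool" where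
  "KS_poincare M dw \<longleftrightarrow>
     (\<exists>C \<Lambda>::real. C > 0 \<and> \<Lambda> \<ge> 1 \<and>
       (\<forall>f\<in>KS_space M dw. \<forall>x. \<forall>R>0.
          (\<integral>\<^sup>+y\<in>ball x R. ennreal (\<bar>f y - ball_average M f x R\<bar>\<^sup>2) \<partial>M)
            \<le> ennreal (C * R powr dw) *
              Liminf (at_right 0) (KS_energy M dw (ball x (\<Lambda> * R)) f)))"

end

theory Submission
  imports Defs "HOL-Complex_Analysis.Great_Picard"
begin

text \<open>
  Cover \<open>X\<close> by the balls \<open>B(s,\<rho>)\<close> around a finite \<open>\<rho>/2\<close>-separated set \<open>S\<close>. By doubling, the
  enlarged balls \<open>B(s,\<Lambda>\<rho>)\<close> overlap a number of times that does not depend on \<open>\<rho>\<close>, so summing the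
  Poincare inequality over \<open>S\<close> bounds the \<open>L\<^sup>2\<close> distance of \<open>f\<^sub>n\<close> to its averages on the cover by
  \<open>D \<rho>\<^bsup>dw\<^esup>\<close> times the energy, uniformly in \<open>n\<close>. A diagonal subsequence makes all averages at the
  scales \<open>\<rho> = 1/(m+1)\<close> converge; it is Cauchy in \<open>L\<^sup>2\<close>, hence convergent.
\<close>

section \<open>Superadditivity of upper integrals and of lower limits\<close>

text \<open>
  The integrand of the Korevaar--Schoen energy is not known to be measurable on a general metric
  space type, so only those inequalities for the upper integral are used that need no measurability.
\<close>

lemma nn_integral_superadd:
  "(\<integral>\<^sup>+x. u x \<partial>M) + (\<integral>\<^sup>+x. v x \<partial>M) \<le> (\<integral>\<^sup>+x. u x + v x \<partial>M)"
proof -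
  have "integral\<^sup>S M s + integral\<^sup>S M t \<le> (\<integral>\<^sup>+x. u x + v x \<partial>M)"
    if s: "simple_function M s" "s \<le> u" and t: "simple_function M t" "t \<le> v" for s t
  proof -
    have "integral\<^sup>S M s + integral\<^sup>S M t = (\<integral>\<^sup>+x. s x + t x \<partial>M)"
      using s t by (subst nn_integral_eq_simple_integral) auto
    also have "\<dots> \<le> (\<integral>\<^sup>+x. u x + v x \<partial>M)"
      using s t by (intro nn_integral_mono add_mono) (auto simp: le_fun_def)
    finally show ?thesis .
  qed
  \<comment> \<open>The two suprema over simple minorants are taken one after the other. The zero
    function witnesses that each family is nonempty, which is required for moving a summand through
    a supremum.\<close>
  then have "integral\<^sup>N M u + integral\<^sup>S M t \<le> (\<integral>\<^sup>+x. u x + v x \<partial>M)"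
    if "simple_function M t" "t \<le> v" for t
    unfolding nn_integral_def[of M u] using that
    by (subst ennreal_SUP_add_left[symmetric])
       (auto intro!: SUP_least exI[of _ "\<lambda>_. 0"] simp: le_fun_def)
  then show ?thesis
    unfolding nn_integral_def[of M v]
    by (subst ennreal_SUP_add_right)
       (auto intro!: SUP_least exI[of _ "\<lambda>_. 0"] simp: le_fun_def)
qed

lemma nn_integral_sum_superadd:
  "(\<Sum>i\<in>I. \<integral>\<^sup>+x. u i x \<partial>M) \<le> (\<integral>\<^sup>+x. (\<Sum>i\<in>I. u i x) \<partial>M)"
proof (induction I rule: infinite_finite_induct)
  case (insert i I)
  then show ?case
    using nn_integral_superadd[of M "u i" "\<lambda>x. \<Sum>i\<in>I. u i x"] by (auto intro: order_trans[OF add_left_mono])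
qed auto

text \<open>A simple minorant of \<open>c * u\<close>, divided by \<open>c\<close>, is a minorant of
  \<open>u\<close>. The constant is therefore only ever pulled out of the integral of a simple
  function, which is measurable.\<close>

lemma nn_integral_cmult_le:
  assumes "c > 0"
  shows "(\<integral>\<^sup>+x. ennreal c * u x \<partial>M) \<le> ennreal c * (\<integral>\<^sup>+x. u x \<partial>M)"
  unfolding nn_integral_def[of M "\<lambda>x. ennreal c * u x"]
proof (intro SUP_least)
  fix s assume "s \<in> {s. simple_function M s \<and> s \<le> (\<lambda>x. ennreal c * u x)}"
  then have s: "simple_function M s" "\<And>x. s x \<le> ennreal c * u x"
    by (auto simp: le_fun_def)
  have c: "ennreal c * ennreal (1 / c) = 1"
    using assms by (simp add: ennreal_mult[symmetric] del: ennreal_1 add: ennreal_1[symmetric])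
  have "integral\<^sup>S M s = (\<integral>\<^sup>+x. ennreal c * (ennreal (1 / c) * s x) \<partial>M)"
    using s by (simp add: nn_integral_eq_simple_integral mult.assoc[symmetric] c)
  also have "\<dots> = ennreal c * (\<integral>\<^sup>+x. ennreal (1 / c) * s x \<partial>M)"
    using s(1) by (intro nn_integral_cmult) (auto intro: borel_measurable_simple_function)
  also have "ennreal (1 / c) * s x \<le> u x" for x
  proof -
    have "ennreal (1 / c) * s x \<le> ennreal (1 / c) * (ennreal c * u x)"
      using s(2) by (intro mult_left_mono) auto
    then show ?thesis
      using c by (simp add: mult.assoc[symmetric] mult.commute)
  qed
  then have "ennreal c * (\<integral>\<^sup>+x. ennreal (1 / c) * s x \<partial>M) \<le> ennreal c * (\<integral>\<^sup>+x. u x \<partial>M)"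
    by (intro mult_left_mono nn_integral_mono) auto
  finally show "integral\<^sup>S M s \<le> ennreal c * (\<integral>\<^sup>+x. u x \<partial>M)" .
qed

text \<open>Where \<open>P\<close> and \<open>Q\<close> both hold, the sum is at least the sum of
  the two infima; then the supremum is taken over \<open>P\<close> and over \<open>Q\<close>. This
  is the direction needed to replace a sum of lower limits of local energies by one lower
  limit.\<close>

lemma Liminf_add_le_ennreal:
  fixes u v :: "'b \<Rightarrow> ennreal"
  shows "Liminf F u + Liminf F v \<le> Liminf F (\<lambda>x. u x + v x)"
proof -
  have "(INF x\<in>Collect P. u x) + (INF x\<in>Collect Q. v x) \<le> Liminf F (\<lambda>x. u x + v x)"
    if "eventually P F" "eventually Q F" for P Q
  proof -
    have "(INF x\<in>Collect P. u x) + (INF x\<in>Collect Q. v x)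
            \<le> (INF x\<in>{x. P x \<and> Q x}. u x + v x)"
      by (intro INF_greatest add_mono INF_lower) auto
    also have "\<dots> \<le> Liminf F (\<lambda>x. u x + v x)"
      unfolding Liminf_def using that by (intro SUP_upper) (auto simp: eventually_conj_iff)
    finally show ?thesis .
  qed
  then have "Liminf F u + (INF x\<in>Collect Q. v x) \<le> Liminf F (\<lambda>x. u x + v x)"
    if "eventually Q F" for Q
    unfolding Liminf_def[of F u] using that
    by (subst ennreal_SUP_add_left[symmetric]) (auto intro!: SUP_least exI[of _ "\<lambda>_. True"])
  then show ?thesis
    unfolding Liminf_def[of F v]
    by (subst ennreal_SUP_add_right) (auto intro!: SUP_least exI[of _ "\<lambda>_. True"])
qed

lemma Liminf_sum_le_ennreal:
  fixes u :: "'c \<Rightarrow> 'b \<Rightarrow> ennreal"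
  shows "(\<Sum>i\<in>I. Liminf F (u i)) \<le> Liminf F (\<lambda>x. \<Sum>i\<in>I. u i x)"
proof (induction I rule: infinite_finite_induct)
  case (insert i I)
  then show ?case
    using Liminf_add_le_ennreal[of F "u i" "\<lambda>x. \<Sum>i\<in>I. u i x"] by (auto intro: order_trans[OF add_left_mono])
qed auto

lemma Liminf_cmult_ennreal:
  fixes u :: "'b \<Rightarrow> ennreal"
  assumes "F \<noteq> bot"
  shows "Liminf F (\<lambda>x. ennreal c * u x) = ennreal c * Liminf F u"
  using Liminf_compose_continuous_mono[of "\<lambda>x. ennreal c * x" F u] assms
  by (simp add: ennreal_continuous_on_cmult continuous_on_id mono_def mult_left_mono)

section \<open>Separated nets and their overlap under doubling\<close>

text \<open>Taking the centres from a finite \<open>\<rho>/2\<close>-cover makes \<open>S\<close> finite by construction.\<close>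

lemma exists_separated_net:
  assumes "compact (UNIV :: 'a::metric_space set)" "\<rho> > 0"
  obtains S :: "'a::metric_space set" where "finite S" "(\<Union>s\<in>S. ball s \<rho>) = UNIV"
    "\<And>s t. s \<in> S \<Longrightarrow> t \<in> S \<Longrightarrow> s \<noteq> t \<Longrightarrow> \<rho> / 2 \<le> dist s t"
proof -
  obtain T :: "'a set" where T: "finite T" "UNIV = (\<Union>x\<in>T. ball x (\<rho> / 2))"
  proof (rule compactE_image[OF assms(1), of UNIV "\<lambda>x. ball x (\<rho> / 2)"])
    have "x \<in> ball x (\<rho> / 2)" for x :: 'a
      using assms(2) by simp
    then show "UNIV \<subseteq> (\<Union>x::'a. ball x (\<rho> / 2))"
      by blast
  qed auto
  define P where "P S \<longleftrightarrow> S \<subseteq> T \<and> (\<forall>s\<in>S. \<forall>t\<in>S. s \<noteq> t \<longrightarrow> \<rho> / 2 \<le> dist s t)" for S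
  have "finite {S. P S}"
    using T(1) by (intro finite_subset[of "{S. P S}" "Pow T"]) (auto simp: P_def)
  moreover have "P {}"
    by (simp add: P_def)
  ultimately obtain S where S: "P S" "\<And>S'. P S' \<Longrightarrow> S \<subseteq> S' \<Longrightarrow> S' = S"
    using finite_has_maximal[of "{S. P S}"] by (metis empty_iff mem_Collect_eq)
  \<comment> \<open>Two half radii add up: \<open>x\<close> is within \<rho>/2 of some
    \<open>t\<close> in \<open>T\<close>, and \<open>t\<close> is within \<rho>/2 of some
    \<open>s\<close> in \<open>S\<close>, since otherwise \<open>t\<close> could be added to the
    maximal set \<open>S\<close>.\<close>
  have cover: "x \<in> (\<Union>s\<in>S. ball s \<rho>)" for x
  proof -
    obtain t where t: "t \<in> T" "dist t x < \<rho> / 2"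
      using UNIV_I[of x] unfolding T(2) by auto
    have "\<exists>s\<in>S. dist s t < \<rho> / 2"
    proof (cases "t \<in> S")
      case True
      then show ?thesis using assms(2) by (intro bexI[of _ t]) auto
    next
      case False
      then have "\<not> P (insert t S)" using S(2)[of "insert t S"] by auto
      then show ?thesis using S(1) t(1)
        by (force simp: P_def dist_commute not_le)
    qed
    then obtain s where "s \<in> S" "dist s t < \<rho> / 2" by auto
    then have "dist s x < \<rho>" using t(2) dist_triangle[of s x t] by auto
    with \<open>s \<in> S\<close> show ?thesis by auto
  qed
  show ?thesis
  proof (rule that[of S])
    show "finite S"
      using S(1) T(1) by (auto simp: P_def intro: finite_subset)
    show "(\<Union>s\<in>S. ball s \<rho>) = UNIV"
      using cover by blast
    show "\<rho> / 2 \<le> dist s t" if "s \<in> S" "t \<in> S" "s \<noteq> t" for s t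
      using S(1) that unfolding P_def by blast
  qed
qed

text \<open>
  The balls \<open>B(s,\<rho>/4)\<close> with \<open>x \<in> B(s,\<Lambda>\<rho>)\<close> are disjoint, lie in \<open>B(x,2\<Lambda>\<rho>)\<close>, and by doubling each
  carries a fixed fraction of its measure.
\<close>

lemma bounded_overlap:
  fixes M :: "'a::metric_space measure"
  assumes sets: "sets M = sets borel" and doubling: "positive_doubling M" and "\<Lambda> \<ge> 1"
  obtains D :: real where "D > 0"
    "\<forall>\<rho>>0. \<forall>(S :: 'a set) x. finite S \<longrightarrow> (\<forall>s\<in>S. \<forall>t\<in>S. s \<noteq> t \<longrightarrow> \<rho> / 2 \<le> dist s t) \<longrightarrow>
       real (card {s\<in>S. x \<in> ball s (\<Lambda> * \<rho>)}) \<le> D"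
proof -
  obtain C where C: "C > 0" "\<And>x r. r > 0 \<Longrightarrow> 0 < emeasure M (ball x (2 * r))"
    "\<And>x r. r > 0 \<Longrightarrow> emeasure M (ball x (2 * r)) \<le> ennreal C * emeasure M (ball x r)"
    "\<And>x r. r > 0 \<Longrightarrow> ennreal C * emeasure M (ball x r) < \<infinity>"
    using doubling unfolding positive_doubling_def by blast
  have fin: "emeasure M (ball x r) < \<infinity>" if "r > 0" for x r
    using C(4)[OF that, of x] C(1) by (auto simp: ennreal_mult_less_top)
  \<comment> \<open>Positivity is stated for balls of doubled radius, hence the instance with
    \<open>r / 2\<close>.\<close>
  have pos: "0 < measure M (ball x r)" if "r > 0" for x r
    using C(2)[of "r / 2" x] fin[OF that, of x] that
    by (simp add: measure_def enn2real_positive_iff)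
  have dbl: "measure M (ball x (2 * r)) \<le> C * measure M (ball x r)" if "r > 0" for x r
    using C(3)[OF that, of x] fin[OF that, of x] fin[of "2 * r" x] that C(1)
    by (simp add: emeasure_eq_ennreal_measure ennreal_mult[symmetric] less_top[symmetric])
  have dbl_pow: "measure M (ball x (2 ^ k * r)) \<le> C ^ k * measure M (ball x r)" if "r > 0" for x r k
  proof (induction k)
    case (Suc k)
    have "measure M (ball x (2 ^ Suc k * r)) \<le> C * measure M (ball x (2 ^ k * r))"
      using dbl[of "2 ^ k * r" x] that by (simp add: mult.assoc)
    also have "\<dots> \<le> C * (C ^ k * measure M (ball x r))"
      using Suc C(1) by (intro mult_left_mono) auto
    finally show ?case by (simp add: mult.assoc)
  qed simp
  \<comment> \<open>A ball around \<open>s\<close> of radius 4\<Lambda>\<rho> =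
    16\<Lambda>(\<rho>/4) contains B(x,2\<Lambda>\<rho>), so \<open>k\<close> doublings starting
    from radius \<rho>/4 suffice, whatever \<rho> is.\<close>
  obtain k where k: "16 * \<Lambda> < 2 ^ k"
    using real_arch_pow[of 2 "16 * \<Lambda>"] by auto
  have card_le: "real (card {s\<in>S. x \<in> ball s (\<Lambda> * \<rho>)}) \<le> C ^ k"
    if \<rho>: "\<rho> > 0" and S: "finite S" and sep: "\<And>s t. s \<in> S \<Longrightarrow> t \<in> S \<Longrightarrow> s \<noteq> t \<Longrightarrow> \<rho> / 2 \<le> dist s t"
    for \<rho> and S :: "'a set" and x
  proof -
    define T where "T = {s\<in>S. x \<in> ball s (\<Lambda> * \<rho>)}"
    have T: "finite T" using S by (simp add: T_def)
    have \<Lambda>\<rho>: "\<rho> \<le> \<Lambda> * \<rho>" using \<rho> \<open>\<Lambda> \<ge> 1\<close> by simp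
    define m where "m = measure M (ball x (2 * (\<Lambda> * \<rho>)))"
    have fin': "ball x r \<in> fmeasurable M" if "r > 0" for x r
      using fin[OF that] by (intro fmeasurableI) (auto simp: sets)
    have "m \<le> C ^ k * measure M (ball s (\<rho> / 4))" if "s \<in> T" for s
    proof -
      have "ball x (2 * (\<Lambda> * \<rho>)) \<subseteq> ball s (2 ^ k * (\<rho> / 4))"
      proof
        fix y assume "y \<in> ball x (2 * (\<Lambda> * \<rho>))"
        then have "dist s y < \<Lambda> * \<rho> + 2 * (\<Lambda> * \<rho>)"
          using that dist_triangle[of s y x] by (auto simp: T_def)
        also have "\<dots> \<le> 4 * (\<Lambda> * \<rho>)" using \<rho> \<Lambda>\<rho> by simp
        also have "\<dots> \<le> 2 ^ k * (\<rho> / 4)"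
          using mult_right_mono[OF less_imp_le[OF k], of "\<rho> / 4"] \<rho> by simp
        finally show "y \<in> ball s (2 ^ k * (\<rho> / 4))" by simp
      qed
      then have "m \<le> measure M (ball s (2 ^ k * (\<rho> / 4)))"
        unfolding m_def using \<rho> \<Lambda>\<rho> by (intro measure_mono_fmeasurable fin') (auto simp: sets)
      with dbl_pow[of "\<rho> / 4" s k] \<rho> show ?thesis by simp
    qed
    \<comment> \<open>Counting by volume: the left side is the cardinality of \<open>T\<close> times
      \<open>m\<close>, and disjointness bounds the right side by \<open>C ^ k * m\<close>. Since
      \<open>m\<close> is positive, it cancels.\<close>
    then have "(\<Sum>s\<in>T. m) \<le> (\<Sum>s\<in>T. C ^ k * measure M (ball s (\<rho> / 4)))"
      by (rule sum_mono)
    also have "\<dots> = C ^ k * (\<Sum>s\<in>T. measure M (ball s (\<rho> / 4)))"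
      by (simp add: sum_distrib_left)
    also have "(\<Sum>s\<in>T. measure M (ball s (\<rho> / 4))) = measure M (\<Union>s\<in>T. ball s (\<rho> / 4))"
    proof (rule measure_finite_Union[symmetric, OF T])
      have False if "s \<in> T" "t \<in> T" "s \<noteq> t" "dist s y < \<rho> / 4" "dist t y < \<rho> / 4" for s t y
        using sep[of s t] dist_triangle2[of s t y] that by (auto simp: T_def)
      then show "disjoint_family_on (\<lambda>s. ball s (\<rho> / 4)) T"
        unfolding disjoint_family_on_def by (simp add: disjoint_iff) blast
      show "emeasure M (ball s (\<rho> / 4)) \<noteq> \<infinity>" for s
        using fin[of "\<rho> / 4" s] \<rho> by auto
    qed (auto simp: sets)
    also have "\<dots> \<le> m"
      unfolding m_def
    proof (rule measure_mono_fmeasurable)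
      show "(\<Union>s\<in>T. ball s (\<rho> / 4)) \<subseteq> ball x (2 * (\<Lambda> * \<rho>))"
      proof
        fix y assume "y \<in> (\<Union>s\<in>T. ball s (\<rho> / 4))"
        then obtain s where "s \<in> T" "dist s y < \<rho> / 4" by auto
        then have "dist x y < 2 * (\<Lambda> * \<rho>)"
          using dist_triangle3[of x y s] \<rho> \<Lambda>\<rho> unfolding T_def mem_Collect_eq mem_ball by linarith
        then show "y \<in> ball x (2 * (\<Lambda> * \<rho>))" by simp
      qed
    qed (use \<rho> \<Lambda>\<rho> in \<open>auto simp: sets intro!: fin' borel_open\<close>)
    finally have "real (card T) * m \<le> C ^ k * m"
      using C(1) by simp
    moreover have "m > 0" unfolding m_def using \<rho> \<Lambda>\<rho> by (intro pos) auto
    ultimately show ?thesis by (simp add: T_def)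
  qed
  show ?thesis
  proof (rule that[of "C ^ k"])
    show "\<forall>\<rho>>0. \<forall>(S :: 'a set) x. finite S \<longrightarrow> (\<forall>s\<in>S. \<forall>t\<in>S. s \<noteq> t \<longrightarrow> \<rho> / 2 \<le> dist s t) \<longrightarrow>
       real (card {s\<in>S. x \<in> ball s (\<Lambda> * \<rho>)}) \<le> C ^ k"
      by (intro allI impI card_le) auto
  qed (use C(1) in simp)
qed

section \<open>Completeness of the space of square-integrable functions\<close>

lemma power2_sum_le: "(a + b)\<^sup>2 \<le> 2 * a\<^sup>2 + 2 * (b::real)\<^sup>2"
  using sum_squares_bound[of a b] by (simp add: power2_sum)

lemma L2_norm_eq_enn2real:
  assumes "f \<in> borel_measurable M"
  shows "L2_norm M f = sqrt (enn2real (\<integral>\<^sup>+x. ennreal ((f x)\<^sup>2) \<partial>M))"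
  unfolding L2_norm_def using assms by (subst integral_eq_nn_integral) auto

lemma L2_space_iff:
  "f \<in> L2_space M \<longleftrightarrow> f \<in> borel_measurable M \<and> (\<integral>\<^sup>+x. ennreal ((f x)\<^sup>2) \<partial>M) < \<infinity>"
  unfolding L2_space_def by (auto simp: integrable_iff_bounded)

text \<open>Riesz-Fischer for functions instead of classes, with the Cauchy condition on squared
  distances: a rapidly converging subsequence has an almost everywhere limit, and Fatou carries the
  Cauchy bounds of the full sequence over to that limit.\<close>

lemma L2_complete:
  fixes f :: "nat \<Rightarrow> 'a \<Rightarrow> real"
  assumes f: "\<And>n. f n \<in> L2_space M"
    and Cauchy: "\<And>\<epsilon>. \<epsilon> > 0 \<Longrightarrow> \<exists>N. \<forall>m\<ge>N. \<forall>n\<ge>N. (\<integral>\<^sup>+x. ennreal ((f m x - f n x)\<^sup>2) \<partial>M) \<le> ennreal \<epsilon>"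
  obtains g where "g \<in> L2_space M" "(\<lambda>n. L2_norm M (\<lambda>x. f n x - g x)) \<longlonglongrightarrow> 0"
proof -
  have [measurable]: "f n \<in> borel_measurable M" for n
    using f by (simp add: L2_space_def)
  \<comment> \<open>The rate 8^(-k) is chosen so that the terms weighted by \<open>2 ^ k\<close> are
    still bounded by 4^(-k), which is summable.\<close>
  obtain N where N: "\<And>k m n. m \<ge> N k \<Longrightarrow> n \<ge> N k \<Longrightarrow>
      (\<integral>\<^sup>+x. ennreal ((f m x - f n x)\<^sup>2) \<partial>M) \<le> ennreal ((1/8) ^ k)"
    using Cauchy[of "(1/8) ^ k" for k] by (metis zero_less_power zero_less_divide_1_iff zero_less_numeral)
  \<comment> \<open>The sum dominates each of \<open>N 0\<close>, ..., \<open>N k\<close>, so both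
    \<open>s k\<close> and \<open>s (Suc k)\<close> lie beyond \<open>N k\<close>; the summand
    \<open>k\<close> forces \<open>s\<close> to infinity, as the Fatou step requires.\<close>
  define s where "s k = k + (\<Sum>i\<le>k. N i)" for k
  have s: "N k \<le> s k" "N k \<le> s (Suc k)" "k \<le> s k" for k
    using member_le_sum[of k "{..k}" N] by (auto simp: s_def)
  define d where "d k x = f (s (Suc k)) x - f (s k) x" for k x
  have [measurable]: "d k \<in> borel_measurable M" for k
    unfolding d_def by measurable
  \<comment> \<open>Since \<open>\<bar>d\<bar> \<le> 2\<^bsup>-k\<^esup> + 2\<^bsup>k\<^esup> d\<^sup>2\<close>, this weighted sum also controls \<open>\<Sum>k. \<bar>d k x\<bar>\<close>.\<close>
  have "(\<integral>\<^sup>+x. (\<Sum>k. ennreal (2 ^ k * (d k x)\<^sup>2)) \<partial>M) = (\<Sum>k. \<integral>\<^sup>+x. ennreal (2 ^ k * (d k x)\<^sup>2) \<partial>M)"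
    by (intro nn_integral_suminf) measurable
  also have "\<dots> \<le> (\<Sum>k. ennreal ((1/4) ^ k))"
  proof (intro suminf_le)
    fix k
    have "(\<integral>\<^sup>+x. ennreal (2 ^ k * (d k x)\<^sup>2) \<partial>M) = ennreal (2 ^ k) * (\<integral>\<^sup>+x. ennreal ((d k x)\<^sup>2) \<partial>M)"
      by (simp add: ennreal_mult nn_integral_cmult)
    also have "\<dots> \<le> ennreal (2 ^ k) * ennreal ((1/8) ^ k)"
      unfolding d_def using N s by (intro mult_left_mono) auto
    also have "\<dots> = ennreal ((2 * (1/8)) ^ k)"
      by (subst ennreal_mult[symmetric]) (simp_all only: power_mult_distrib, auto)
    finally show "(\<integral>\<^sup>+x. ennreal (2 ^ k * (d k x)\<^sup>2) \<partial>M) \<le> ennreal ((1/4) ^ k)"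
      by simp
  qed auto
  also have "\<dots> < \<infinity>"
    by (subst suminf_ennreal2) (auto simp: summable_geometric)
  finally have "AE x in M. (\<Sum>k. ennreal (2 ^ k * (d k x)\<^sup>2)) \<noteq> \<infinity>"
    by (intro nn_integral_PInf_AE) auto
  then have conv: "AE x in M. convergent (\<lambda>k. f (s k) x)"
  proof eventually_elim
    fix x assume "(\<Sum>k. ennreal (2 ^ k * (d k x)\<^sup>2)) \<noteq> \<infinity>"
    then have "summable (\<lambda>k. (1/2) ^ k + 2 ^ k * (d k x)\<^sup>2)"
      by (intro summable_add summable_suminf_not_top summable_geometric) auto
    moreover have "norm (d k x) \<le> (1/2) ^ k + 2 ^ k * (d k x)\<^sup>2" for k
    proof (cases "\<bar>d k x\<bar> \<le> (1/2) ^ k")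
      case False
      then have "1 \<le> 2 ^ k * \<bar>d k x\<bar>"
        by (simp add: power_one_over field_simps)
      then have "1 * \<bar>d k x\<bar> \<le> 2 ^ k * \<bar>d k x\<bar> * \<bar>d k x\<bar>"
        by (intro mult_right_mono) auto
      then show ?thesis
        by (simp add: power2_eq_square mult.assoc add_increasing)
    qed (simp add: add_increasing2)
    ultimately have "summable (\<lambda>k. d k x)"
      by (rule summable_comparison_test'[where N = 0])
    then have "convergent (\<lambda>n. f (s 0) x + (\<Sum>k<n. d k x))"
      by (intro convergent_add convergent_const) (simp add: summable_iff_convergent)
    then show "convergent (\<lambda>k. f (s k) x)"
      using sum_lessThan_telescope[of "\<lambda>k. f (s k) x"] by (simp add: d_def)
  qed
  \<comment> \<open>Where the subsequence diverges, \<open>lim\<close> takes one fixed unspecified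
    value; this happens only on a null set.\<close>
  define g where "g x = lim (\<lambda>k. f (s k) x)" for x
  have [measurable]: "g \<in> borel_measurable M"
    unfolding g_def by measurable
  \<comment> \<open>The index \<open>n\<close> stays fixed while the other index runs along
    \<open>s\<close>, so the bound for the pair (\<open>n\<close>, \<open>s k\<close>) passes to the
    limit with the same \<epsilon> and \<open>N\<close>.\<close>
  have Fatou: "(\<integral>\<^sup>+x. ennreal ((f n x - g x)\<^sup>2) \<partial>M) \<le> ennreal \<epsilon>"
    if "\<forall>m\<ge>N. \<forall>n\<ge>N. (\<integral>\<^sup>+x. ennreal ((f m x - f n x)\<^sup>2) \<partial>M) \<le> ennreal \<epsilon>" "n \<ge> N" for \<epsilon> N n
  proof -
    have "(\<integral>\<^sup>+x. ennreal ((f n x - g x)\<^sup>2) \<partial>M)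
            = (\<integral>\<^sup>+x. liminf (\<lambda>k. ennreal ((f n x - f (s k) x)\<^sup>2)) \<partial>M)"
    proof (rule nn_integral_cong_AE)
      show "AE x in M. ennreal ((f n x - g x)\<^sup>2) = liminf (\<lambda>k. ennreal ((f n x - f (s k) x)\<^sup>2))"
        using conv
      proof eventually_elim
        fix x assume "convergent (\<lambda>k. f (s k) x)"
        then have "(\<lambda>k. f (s k) x) \<longlonglongrightarrow> g x"
          by (simp add: g_def convergent_LIMSEQ_iff)
        then have "(\<lambda>k. ennreal ((f n x - f (s k) x)\<^sup>2)) \<longlonglongrightarrow> ennreal ((f n x - g x)\<^sup>2)"
          by (intro tendsto_ennrealI tendsto_intros)
        then show "ennreal ((f n x - g x)\<^sup>2) = liminf (\<lambda>k. ennreal ((f n x - f (s k) x)\<^sup>2))"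
          by (rule lim_imp_Liminf[OF sequentially_bot, symmetric])
      qed
    qed
    also have "\<dots> \<le> liminf (\<lambda>k. \<integral>\<^sup>+x. ennreal ((f n x - f (s k) x)\<^sup>2) \<partial>M)"
      by (intro nn_integral_liminf) measurable
    also have "\<dots> \<le> liminf (\<lambda>k::nat. ennreal \<epsilon>)"
    proof (rule Liminf_mono)
      show "\<forall>\<^sub>F k in sequentially. (\<integral>\<^sup>+x. ennreal ((f n x - f (s k) x)\<^sup>2) \<partial>M) \<le> ennreal \<epsilon>"
        using eventually_ge_at_top[of N]
      proof eventually_elim
        case (elim k)
        then show ?case using that s(3)[of k] by auto
      qed
    qed
    finally show ?thesis by (simp add: Liminf_const)
  qed
  have "g \<in> L2_space M"
  proof -
    obtain N where "\<forall>m\<ge>N. \<forall>n\<ge>N. (\<integral>\<^sup>+x. ennreal ((f m x - f n x)\<^sup>2) \<partial>M) \<le> ennreal 1"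
      using Cauchy[of 1] by auto
    then have N: "(\<integral>\<^sup>+x. ennreal ((f N x - g x)\<^sup>2) \<partial>M) \<le> ennreal 1"
      by (rule Fatou) simp
    have "(\<integral>\<^sup>+x. ennreal ((g x)\<^sup>2) \<partial>M)
            \<le> (\<integral>\<^sup>+x. 2 * ennreal ((f N x)\<^sup>2) + 2 * ennreal ((f N x - g x)\<^sup>2) \<partial>M)"
    proof (rule nn_integral_mono)
      fix x
      have "ennreal ((g x)\<^sup>2) \<le> ennreal (2 * (f N x)\<^sup>2 + 2 * (f N x - g x)\<^sup>2)"
        using power2_sum_le[of "f N x" "g x - f N x"] by (intro ennreal_leI) (simp add: power2_commute)
      then show "ennreal ((g x)\<^sup>2) \<le> 2 * ennreal ((f N x)\<^sup>2) + 2 * ennreal ((f N x - g x)\<^sup>2)"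
        by (simp add: ennreal_mult)
    qed
    also have "\<dots> = 2 * (\<integral>\<^sup>+x. ennreal ((f N x)\<^sup>2) \<partial>M) + 2 * (\<integral>\<^sup>+x. ennreal ((f N x - g x)\<^sup>2) \<partial>M)"
      by (simp add: nn_integral_add nn_integral_cmult)
    also have "\<dots> < \<infinity>"
      using N f[of N] by (auto simp: L2_space_iff ennreal_mult_less_top intro: le_less_trans)
    finally show ?thesis
      by (simp add: L2_space_iff)
  qed
  moreover have "(\<lambda>n. L2_norm M (\<lambda>x. f n x - g x)) \<longlonglongrightarrow> 0"
  proof -
    have "(\<lambda>n. enn2real (\<integral>\<^sup>+x. ennreal ((f n x - g x)\<^sup>2) \<partial>M)) \<longlonglongrightarrow> 0"
    proof (rule LIMSEQ_I)
      fix \<epsilon> :: real assume "\<epsilon> > 0"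
      \<comment> \<open>The bound from Fatou is not strict, so it is requested for
        \<epsilon>/2.\<close>
      then obtain N where "\<forall>m\<ge>N. \<forall>n\<ge>N. (\<integral>\<^sup>+x. ennreal ((f m x - f n x)\<^sup>2) \<partial>M) \<le> ennreal (\<epsilon> / 2)"
        using Cauchy[of "\<epsilon> / 2"] by auto
      from Fatou[OF this] have "enn2real (\<integral>\<^sup>+x. ennreal ((f n x - g x)\<^sup>2) \<partial>M) \<le> \<epsilon> / 2" if "n \<ge> N" for n
        using that \<open>\<epsilon> > 0\<close> by (intro enn2real_leI) auto
      then show "\<exists>N. \<forall>n\<ge>N. norm (enn2real (\<integral>\<^sup>+x. ennreal ((f n x - g x)\<^sup>2) \<partial>M) - 0) < \<epsilon>"
        using \<open>\<epsilon> > 0\<close> by (intro exI[of _ N]) (force simp: intro: le_less_trans)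
    qed
    from tendsto_real_sqrt[OF this] show ?thesis
      by (simp add: L2_norm_eq_enn2real)
  qed
  ultimately show ?thesis using that by blast
qed

section \<open>Summing the Poincare inequality over a net\<close>

text \<open>\<open>D\<close> is the Poincare constant times the overlap bound, hence independent of
  \<rho>. The order of quantifiers matters: the cover is chosen before \<open>g\<close>, so that one
  cover per scale serves every function of the sequence.\<close>

lemma poincare_on_net:
  fixes M :: "'a::metric_space measure"
  assumes "compact (UNIV :: 'a set)" and sets: "sets M = sets borel"
    and "positive_doubling M" and "KS_poincare M dw"
  obtains D :: real where "D > 0"
    "\<forall>\<rho>>0. \<exists>S. finite S \<and> (\<Union>s\<in>S. ball s \<rho>) = UNIV \<and>
      (\<forall>g\<in>KS_space M dw.
        (\<Sum>s\<in>S. \<integral>\<^sup>+y\<in>ball s \<rho>. ennreal ((g y - ball_average M g s \<rho>)\<^sup>2) \<partial>M)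
          \<le> ennreal (D * \<rho> powr dw) * Liminf (at_right 0) (KS_energy M dw UNIV g))"
proof -
  obtain C \<Lambda> :: real where C: "C > 0" and \<Lambda>: "\<Lambda> \<ge> 1"
    and "\<forall>g\<in>KS_space M dw. \<forall>x. \<forall>R>0.
          (\<integral>\<^sup>+y\<in>ball x R. ennreal (\<bar>g y - ball_average M g x R\<bar>\<^sup>2) \<partial>M)
            \<le> ennreal (C * R powr dw) * Liminf (at_right 0) (KS_energy M dw (ball x (\<Lambda> * R)) g)"
    using assms(4) unfolding KS_poincare_def by blast
  then have poincare: "(\<integral>\<^sup>+y\<in>ball x R. ennreal (\<bar>g y - ball_average M g x R\<bar>\<^sup>2) \<partial>M)
            \<le> ennreal (C * R powr dw) * Liminf (at_right 0) (KS_energy M dw (ball x (\<Lambda> * R)) g)"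
    if "g \<in> KS_space M dw" "R > 0" for g x R
    using that by blast
  obtain N :: real where N: "N > 0"
    and overlap: "\<forall>\<rho>>0. \<forall>(S :: 'a set) x. finite S \<longrightarrow>
       (\<forall>s\<in>S. \<forall>t\<in>S. s \<noteq> t \<longrightarrow> \<rho> / 2 \<le> dist s t) \<longrightarrow>
       real (card {s\<in>S. x \<in> ball s (\<Lambda> * \<rho>)}) \<le> N"
    using bounded_overlap[OF sets assms(3) \<Lambda>] by metis
  have "\<exists>S. finite S \<and> (\<Union>s\<in>S. ball s \<rho>) = UNIV \<and>
      (\<forall>g\<in>KS_space M dw.
        (\<Sum>s\<in>S. \<integral>\<^sup>+y\<in>ball s \<rho>. ennreal ((g y - ball_average M g s \<rho>)\<^sup>2) \<partial>M)
          \<le> ennreal (C * N * \<rho> powr dw) * Liminf (at_right 0) (KS_energy M dw UNIV g))"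
    if \<rho>: "\<rho> > 0" for \<rho>
  proof -
    obtain S :: "'a set" where S: "finite S" "(\<Union>s\<in>S. ball s \<rho>) = UNIV"
      "\<And>s t. s \<in> S \<Longrightarrow> t \<in> S \<Longrightarrow> s \<noteq> t \<Longrightarrow> \<rho> / 2 \<le> dist s t"
      using exists_separated_net[OF assms(1) \<rho>] by blast
    have energy: "(\<Sum>s\<in>S. KS_energy M dw (ball s (\<Lambda> * \<rho>)) g r) \<le> ennreal N * KS_energy M dw UNIV g r" for g r
    proof -
      \<comment> \<open>The energy density does not depend on the set over which the energy is
        taken. All local energies are integrals of the same \<open>h\<close>, and summing their
        indicators only counts the balls that contain \<open>x\<close>.\<close>
      define h where "h x = 1 / emeasure M (ball x r) *
        (\<integral>\<^sup>+y\<in>ball x r. ennreal (\<bar>g y - g x\<bar>\<^sup>2 / r powr dw) \<partial>M)" for x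
      have "(\<Sum>s\<in>S. KS_energy M dw (ball s (\<Lambda> * \<rho>)) g r)
              = (\<Sum>s\<in>S. \<integral>\<^sup>+x. h x * indicator (ball s (\<Lambda> * \<rho>)) x \<partial>M)"
        by (simp add: KS_energy_def h_def)
      also have "\<dots> \<le> (\<integral>\<^sup>+x. (\<Sum>s\<in>S. h x * indicator (ball s (\<Lambda> * \<rho>)) x) \<partial>M)"
        by (rule nn_integral_sum_superadd)
      also have "\<dots> \<le> (\<integral>\<^sup>+x. ennreal N * h x \<partial>M)"
      proof (rule nn_integral_mono)
        fix x
        have "(\<Sum>s\<in>S. h x * indicator (ball s (\<Lambda> * \<rho>)) x)
                = h x * of_nat (card {s\<in>S. x \<in> ball s (\<Lambda> * \<rho>)})"
          unfolding sum_distrib_left[symmetric] using S(1)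
          by (simp add: indicator_def sum.If_cases Int_def)
        also have "\<dots> \<le> h x * ennreal N"
          using overlap \<rho> S(1,3) unfolding ennreal_of_nat_eq_real_of_nat
          by (intro mult_left_mono ennreal_leI) auto
        finally show "(\<Sum>s\<in>S. h x * indicator (ball s (\<Lambda> * \<rho>)) x) \<le> ennreal N * h x"
          by (simp add: mult.commute)
      qed
      also have "\<dots> \<le> ennreal N * (\<integral>\<^sup>+x. h x \<partial>M)"
        using N by (rule nn_integral_cmult_le)
      finally show ?thesis
        by (simp add: KS_energy_def h_def)
    qed
    have "(\<Sum>s\<in>S. \<integral>\<^sup>+y\<in>ball s \<rho>. ennreal ((g y - ball_average M g s \<rho>)\<^sup>2) \<partial>M)
            \<le> ennreal (C * N * \<rho> powr dw) * Liminf (at_right 0) (KS_energy M dw UNIV g)"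
      if g: "g \<in> KS_space M dw" for g
    proof -
      have "(\<Sum>s\<in>S. \<integral>\<^sup>+y\<in>ball s \<rho>. ennreal ((g y - ball_average M g s \<rho>)\<^sup>2) \<partial>M)
              \<le> (\<Sum>s\<in>S. ennreal (C * \<rho> powr dw) * Liminf (at_right 0) (KS_energy M dw (ball s (\<Lambda> * \<rho>)) g))"
        using poincare[OF g \<rho>] by (intro sum_mono) simp
      also have "\<dots> = ennreal (C * \<rho> powr dw) * (\<Sum>s\<in>S. Liminf (at_right 0) (KS_energy M dw (ball s (\<Lambda> * \<rho>)) g))"
        by (simp add: sum_distrib_left)
      \<comment> \<open>The sum moves inside the lower limit because the overlap bound
        \<open>energy\<close> compares energies at one common \<open>r\<close>.\<close>
      also have "\<dots> \<le> ennreal (C * \<rho> powr dw) *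
          Liminf (at_right 0) (\<lambda>r. \<Sum>s\<in>S. KS_energy M dw (ball s (\<Lambda> * \<rho>)) g r)"
        by (intro mult_left_mono Liminf_sum_le_ennreal) auto
      also have "\<dots> \<le> ennreal (C * \<rho> powr dw) *
          Liminf (at_right 0) (\<lambda>r. ennreal N * KS_energy M dw UNIV g r)"
        using energy by (intro mult_left_mono Liminf_mono always_eventually) auto
      also have "\<dots> = ennreal (C * N * \<rho> powr dw) * Liminf (at_right 0) (KS_energy M dw UNIV g)"
        using C N by (simp add: Liminf_cmult_ennreal ennreal_mult mult_ac)
      finally show ?thesis .
    qed
    with S(1,2) show ?thesis by (intro exI[of _ S]) simp
  qed
  with C N show ?thesis
    by (intro that[of "C * N"]) simp_all
qed

section \<open>Two elementary square-integral estimates\<close>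

text \<open>A triangle inequality for squared norms, at the price of a factor 2. It serves first to
  replace averages by their limits and then to compare two functions through a common
  constant.\<close>

lemma set_nn_integral_power2_sum_le:
  fixes u v :: "'a \<Rightarrow> real"
  assumes [measurable]: "B \<in> sets M" "u \<in> borel_measurable M" "v \<in> borel_measurable M"
  shows "(\<integral>\<^sup>+x\<in>B. ennreal ((u x + v x)\<^sup>2) \<partial>M)
    \<le> 2 * (\<integral>\<^sup>+x\<in>B. ennreal ((u x)\<^sup>2) \<partial>M) + 2 * (\<integral>\<^sup>+x\<in>B. ennreal ((v x)\<^sup>2) \<partial>M)"
proof -
  have "(\<integral>\<^sup>+x\<in>B. ennreal ((u x + v x)\<^sup>2) \<partial>M)
      \<le> (\<integral>\<^sup>+x. 2 * (ennreal ((u x)\<^sup>2) * indicator B x) + 2 * (ennreal ((v x)\<^sup>2) * indicator B x) \<partial>M)"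
  proof (rule nn_integral_mono)
    fix x
    have "ennreal ((u x + v x)\<^sup>2) \<le> ennreal (2 * (u x)\<^sup>2 + 2 * (v x)\<^sup>2)"
      by (intro ennreal_leI power2_sum_le)
    then show "ennreal ((u x + v x)\<^sup>2) * indicator B x
        \<le> 2 * (ennreal ((u x)\<^sup>2) * indicator B x) + 2 * (ennreal ((v x)\<^sup>2) * indicator B x)"
      by (auto simp: ennreal_mult split: split_indicator)
  qed
  also have "\<dots> = 2 * (\<integral>\<^sup>+x\<in>B. ennreal ((u x)\<^sup>2) \<partial>M) + 2 * (\<integral>\<^sup>+x\<in>B. ennreal ((v x)\<^sup>2) \<partial>M)"
    by (simp add: nn_integral_add nn_integral_cmult)
  finally show ?thesis .
qed

text \<open>Integrate |t| \<le> 1 + t^2. The bound is the same for all \<open>A\<close>, which gives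
  boundedness of the integrals over all balls of all covers at once.\<close>

lemma abs_set_integral_le_L2:
  assumes "g \<in> L2_space M" "emeasure M (space M) < \<infinity>"
  shows "\<bar>LINT y:A|M. g y\<bar> \<le> measure M (space M) + (L2_norm M g)\<^sup>2"
proof -
  have int: "integrable M (\<lambda>y. (g y)\<^sup>2)" "integrable M (\<lambda>y. 1::real)"
    using assms finite_measure.integrable_const[OF finite_measureI, of M 1]
    by (simp_all add: L2_space_def less_top)
  have "\<bar>LINT y:A|M. g y\<bar> \<le> (LINT y|M. \<bar>indicator A y *\<^sub>R g y\<bar>)"
    unfolding set_lebesgue_integral_def by (rule integral_abs_bound)
  also have "\<dots> \<le> (LINT y|M. 1 + (g y)\<^sup>2)"
  proof (rule integral_mono')
    show "integrable M (\<lambda>y. 1 + (g y)\<^sup>2)"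
      using int by (intro Bochner_Integration.integrable_add)
    have "\<bar>t\<bar> \<le> 1 + t\<^sup>2" for t :: real
      using sum_squares_bound[of 1 "\<bar>t\<bar>"] by simp
    then show "\<bar>indicator A y *\<^sub>R g y\<bar> \<le> 1 + (g y)\<^sup>2" for y
      by (auto split: split_indicator)
  qed simp
  also have "\<dots> = measure M (space M) + (L2_norm M g)\<^sup>2"
    using int by (simp add: L2_norm_def)
  finally show ?thesis .
qed

section \<open>Extraction of the subsequence and the Cauchy estimate\<close>

theorem corollary4p5:
  fixes M :: "'a::metric_space measure" and dw :: real and f :: "nat \<Rightarrow> 'a \<Rightarrow> real"
  assumes "dw > 2"
    and "compact (UNIV :: 'a set)"
    and "radon_measure M"
    and "positive_doubling M"
    and "KS_poincare M dw"
    and "\<And>n. f n \<in> KS_space M dw"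
    and "(SUP n. ennreal (L2_norm M (f n)) +
            Liminf (at_right 0) (KS_energy M dw UNIV (f n))) < \<infinity>"
  shows "\<exists>\<phi> g. strict_mono (\<phi> :: nat \<Rightarrow> nat) \<and> g \<in> L2_space M \<and>
           (\<lambda>k. L2_norm M (\<lambda>x. f (\<phi> k) x - g x)) \<longlonglongrightarrow> 0"
proof -
  have sets: "sets M = sets borel" and "emeasure M UNIV < \<infinity>"
    using assms(2,3) unfolding radon_measure_def by blast+
  have space: "space M = UNIV"
    using sets_eq_imp_space_eq[OF sets] by simp
  have finite: "emeasure M A < \<infinity>" for A
    using \<open>emeasure M UNIV < \<infinity>\<close> emeasure_space[of M A] space by (auto intro: le_less_trans)
  have [measurable]: "ball x r \<in> sets M" for x r
    by (simp add: sets)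
  have f_L2: "f n \<in> L2_space M" for n
    using assms(6) by (simp add: KS_space_def)
  then have [measurable]: "f n \<in> borel_measurable M" for n
    by (simp add: L2_space_def)
  obtain K where K: "K \<ge> 0" "(SUP n. ennreal (L2_norm M (f n)) +
            Liminf (at_right 0) (KS_energy M dw UNIV (f n))) = ennreal K"
    using assms(7) by (auto simp: less_top_ennreal)
  have bound: "ennreal (L2_norm M (f n)) + Liminf (at_right 0) (KS_energy M dw UNIV (f n)) \<le> ennreal K" for n
    unfolding K(2)[symmetric] by (rule SUP_upper) simp
  have norm_le: "L2_norm M (f n) \<le> K" for n
    using order_trans[OF add_increasing2[OF _ order_refl] bound[of n]] K(1) by simp
  have energy_le: "Liminf (at_right 0) (KS_energy M dw UNIV (f n)) \<le> ennreal K" for n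
    using order_trans[OF add_increasing[OF _ order_refl] bound[of n]] by simp

  obtain D where D: "D > 0" and net: "\<forall>\<rho>>0. \<exists>S. finite S \<and> (\<Union>s\<in>S. ball s \<rho>) = UNIV \<and>
      (\<forall>g\<in>KS_space M dw.
        (\<Sum>s\<in>S. \<integral>\<^sup>+y\<in>ball s \<rho>. ennreal ((g y - ball_average M g s \<rho>)\<^sup>2) \<partial>M)
          \<le> ennreal (D * \<rho> powr dw) * Liminf (at_right 0) (KS_energy M dw UNIV g))"
    by (rule poincare_on_net[OF assms(2) sets assms(4,5)])
  define \<rho> where "\<rho> m = inverse (real (Suc m))" for m
  have "\<forall>m. \<exists>S. finite S \<and> (\<Union>s\<in>S. ball s (\<rho> m)) = UNIV \<and>
      (\<forall>g\<in>KS_space M dw.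
        (\<Sum>s\<in>S. \<integral>\<^sup>+y\<in>ball s (\<rho> m). ennreal ((g y - ball_average M g s (\<rho> m))\<^sup>2) \<partial>M)
          \<le> ennreal (D * \<rho> m powr dw) * Liminf (at_right 0) (KS_energy M dw UNIV g))"
    using net by (simp add: \<rho>_def)
  then obtain S where "\<forall>m. finite (S m) \<and> (\<Union>s\<in>S m. ball s (\<rho> m)) = UNIV \<and>
      (\<forall>g\<in>KS_space M dw.
        (\<Sum>s\<in>S m. \<integral>\<^sup>+y\<in>ball s (\<rho> m). ennreal ((g y - ball_average M g s (\<rho> m))\<^sup>2) \<partial>M)
          \<le> ennreal (D * \<rho> m powr dw) * Liminf (at_right 0) (KS_energy M dw UNIV g))"
    by (rule choice[THEN exE])
  then have S: "finite (S m)" "(\<Union>s\<in>S m. ball s (\<rho> m)) = UNIV"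
    and osc: "(\<Sum>s\<in>S m. \<integral>\<^sup>+y\<in>ball s (\<rho> m). ennreal ((f n y - ball_average M (f n) s (\<rho> m))\<^sup>2) \<partial>M)
          \<le> ennreal (D * \<rho> m powr dw) * Liminf (at_right 0) (KS_energy M dw UNIV (f n))" for m n
    using assms(6) by simp_all

  \<comment> \<open>Integrals are used in place of averages because the subsequence extraction asks
    for one bound valid for all pairs (scale, centre); dividing by the measures of shrinking balls
    could destroy it. The fixed factor is restored ball by ball afterwards.\<close>
  define F where "F n p = (LINT y:ball (snd p) (\<rho> (fst p))|M. f n y)" for n p
  have F_le: "norm (F n p) \<le> measure M UNIV + K\<^sup>2" for n p
  proof -
    have "\<bar>F n p\<bar> \<le> measure M UNIV + (L2_norm M (f n))\<^sup>2"
      using abs_set_integral_le_L2[OF f_L2[of n] finite] by (simp add: F_def space)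
    also have "\<dots> \<le> measure M UNIV + K\<^sup>2"
      using norm_le by (intro add_left_mono power_mono) (auto simp: L2_norm_def)
    finally show ?thesis by simp
  qed
  \<comment> \<open>There are countably many balls over all scales together, so one diagonal
    subsequence serves every scale.\<close>
  have "countable (SIGMA m:UNIV. S m)"
    using S(1) by (intro countable_SIGMA) (auto intro: countable_finite)
  then obtain \<phi> :: "nat \<Rightarrow> nat" where \<phi>: "strict_mono \<phi>"
    "\<And>p. p \<in> (SIGMA m:UNIV. S m) \<Longrightarrow> \<exists>l. (\<lambda>n. F (\<phi> n) p) \<longlonglongrightarrow> l"
    using function_convergent_subsequence[of "SIGMA m:UNIV. S m" F "measure M UNIV + K\<^sup>2"] F_le by metis
  define a where "a m s = lim (\<lambda>n. ball_average M (f (\<phi> n)) s (\<rho> m))" for m s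
  have a: "(\<lambda>n. ball_average M (f (\<phi> n)) s (\<rho> m)) \<longlonglongrightarrow> a m s" if s: "s \<in> S m" for m s
  proof -
    obtain l where "(\<lambda>n. F (\<phi> n) (m, s)) \<longlonglongrightarrow> l"
      using \<phi>(2)[of "(m, s)"] s by auto
    from tendsto_mult_left[OF this, of "1 / measure M (ball s (\<rho> m))"] show ?thesis
      by (simp add: a_def convergent_LIMSEQ_iff[symmetric] convergentI ball_average_def F_def)
  qed
  \<comment> \<open>The squared error, summed over the cover at scale \<open>m\<close>, of replacing
    averages by their limits. For fixed \<open>m\<close> it vanishes as \<open>n\<close> grows,
    because the sum is finite.\<close>
  define T where "T m n = (\<Sum>s\<in>S m. measure M (ball s (\<rho> m)) *
      (ball_average M (f (\<phi> n)) s (\<rho> m) - a m s)\<^sup>2)" for m n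
  have T: "T m \<longlonglongrightarrow> 0" for m
  proof -
    have "T m \<longlonglongrightarrow> (\<Sum>s\<in>S m. measure M (ball s (\<rho> m)) * (a m s - a m s)\<^sup>2)"
      unfolding T_def[abs_def] by (intro tendsto_intros a)
    then show ?thesis by simp
  qed
  have T_nonneg: "T m n \<ge> 0" for m n
    unfolding T_def by (intro sum_nonneg) auto

  \<comment> \<open>On each ball the deviation from \<open>a m s\<close> splits into the oscillation
    around the average, controlled by \<open>osc\<close>, and the constant error of the average,
    collected in \<open>T\<close>.\<close>
  have dev: "(\<Sum>s\<in>S m. \<integral>\<^sup>+y\<in>ball s (\<rho> m). ennreal ((f (\<phi> n) y - a m s)\<^sup>2) \<partial>M)
      \<le> ennreal (2 * (D * \<rho> m powr dw * K) + 2 * T m n)" for m n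
  proof -
    let ?A = "\<lambda>s. ball_average M (f (\<phi> n)) s (\<rho> m)"
    have "(\<Sum>s\<in>S m. \<integral>\<^sup>+y\<in>ball s (\<rho> m). ennreal ((f (\<phi> n) y - a m s)\<^sup>2) \<partial>M)
      \<le> (\<Sum>s\<in>S m. 2 * (\<integral>\<^sup>+y\<in>ball s (\<rho> m). ennreal ((f (\<phi> n) y - ?A s)\<^sup>2) \<partial>M)
            + 2 * ennreal (measure M (ball s (\<rho> m)) * (?A s - a m s)\<^sup>2))"
    proof (rule sum_mono)
      fix s
      have "(\<integral>\<^sup>+y\<in>ball s (\<rho> m). ennreal ((?A s - a m s)\<^sup>2) \<partial>M)
          = ennreal (measure M (ball s (\<rho> m)) * (?A s - a m s)\<^sup>2)"
        using finite[of "ball s (\<rho> m)"]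
        by (subst nn_integral_cmult_indicator)
           (simp_all add: emeasure_eq_ennreal_measure ennreal_mult mult.commute less_top)
      then show "(\<integral>\<^sup>+y\<in>ball s (\<rho> m). ennreal ((f (\<phi> n) y - a m s)\<^sup>2) \<partial>M)
          \<le> 2 * (\<integral>\<^sup>+y\<in>ball s (\<rho> m). ennreal ((f (\<phi> n) y - ?A s)\<^sup>2) \<partial>M)
            + 2 * ennreal (measure M (ball s (\<rho> m)) * (?A s - a m s)\<^sup>2)"
        using set_nn_integral_power2_sum_le[of "ball s (\<rho> m)" M "\<lambda>y. f (\<phi> n) y - ?A s" "\<lambda>y. ?A s - a m s"]
        by simp
    qed
    also have "\<dots> = 2 * (\<Sum>s\<in>S m. \<integral>\<^sup>+y\<in>ball s (\<rho> m). ennreal ((f (\<phi> n) y - ?A s)\<^sup>2) \<partial>M) + 2 * ennreal (T m n)"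
      by (simp add: sum.distrib sum_distrib_left[symmetric] T_def sum_ennreal)
    also have "\<dots> \<le> 2 * (ennreal (D * \<rho> m powr dw) * ennreal K) + 2 * ennreal (T m n)"
      by (intro add_right_mono mult_left_mono order_trans[OF osc] energy_le) auto
    also have "\<dots> = ennreal (2 * (D * \<rho> m powr dw * K) + 2 * T m n)"
      using D K(1) T_nonneg by (simp add: ennreal_mult)
    finally show ?thesis .
  qed

  \<comment> \<open>On each ball both functions are compared with the same constant
    \<open>a m s\<close>, and the integral over the space is at most the sum over the cover. Two
    successive splittings give the factor 4 before each \<open>T\<close>; the Poincare term occurs
    once per function, hence 8.\<close>
  have diff: "(\<integral>\<^sup>+y. ennreal ((f (\<phi> n) y - f (\<phi> k) y)\<^sup>2) \<partial>M)
      \<le> ennreal (8 * D * K * \<rho> m powr dw + 4 * T m n + 4 * T m k)" for m n k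
  proof -
    have "(\<integral>\<^sup>+y. ennreal ((f (\<phi> n) y - f (\<phi> k) y)\<^sup>2) \<partial>M)
        \<le> (\<integral>\<^sup>+y. (\<Sum>s\<in>S m. ennreal ((f (\<phi> n) y - f (\<phi> k) y)\<^sup>2) * indicator (ball s (\<rho> m)) y) \<partial>M)"
    proof (rule nn_integral_mono)
      fix y
      obtain s where "s \<in> S m" "y \<in> ball s (\<rho> m)"
        using S(2)[of m] by blast
      then show "ennreal ((f (\<phi> n) y - f (\<phi> k) y)\<^sup>2)
          \<le> (\<Sum>s\<in>S m. ennreal ((f (\<phi> n) y - f (\<phi> k) y)\<^sup>2) * indicator (ball s (\<rho> m)) y)"
        using member_le_sum[of s "S m" "\<lambda>s. ennreal ((f (\<phi> n) y - f (\<phi> k) y)\<^sup>2) * indicator (ball s (\<rho> m)) y"] S(1)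
        by simp
    qed
    also have "\<dots> = (\<Sum>s\<in>S m. \<integral>\<^sup>+y\<in>ball s (\<rho> m). ennreal ((f (\<phi> n) y - f (\<phi> k) y)\<^sup>2) \<partial>M)"
      by (intro nn_integral_sum) measurable
    also have "\<dots> \<le> (\<Sum>s\<in>S m. 2 * (\<integral>\<^sup>+y\<in>ball s (\<rho> m). ennreal ((f (\<phi> n) y - a m s)\<^sup>2) \<partial>M)
          + 2 * (\<integral>\<^sup>+y\<in>ball s (\<rho> m). ennreal ((f (\<phi> k) y - a m s)\<^sup>2) \<partial>M))"
    proof (rule sum_mono)
      fix s
      show "(\<integral>\<^sup>+y\<in>ball s (\<rho> m). ennreal ((f (\<phi> n) y - f (\<phi> k) y)\<^sup>2) \<partial>M)
        \<le> 2 * (\<integral>\<^sup>+y\<in>ball s (\<rho> m). ennreal ((f (\<phi> n) y - a m s)\<^sup>2) \<partial>M)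
          + 2 * (\<integral>\<^sup>+y\<in>ball s (\<rho> m). ennreal ((f (\<phi> k) y - a m s)\<^sup>2) \<partial>M)"
        using set_nn_integral_power2_sum_le[of "ball s (\<rho> m)" M "\<lambda>y. f (\<phi> n) y - a m s" "\<lambda>y. a m s - f (\<phi> k) y"]
        by (simp add: power2_commute[of "a m s"])
    qed
    also have "\<dots> \<le> 2 * ennreal (2 * (D * \<rho> m powr dw * K) + 2 * T m n)
        + 2 * ennreal (2 * (D * \<rho> m powr dw * K) + 2 * T m k)"
      unfolding sum.distrib sum_distrib_left[symmetric]
      by (intro add_mono mult_left_mono dev) auto
    also have "\<dots> = ennreal (2 * (2 * (D * \<rho> m powr dw * K) + 2 * T m n)
        + 2 * (2 * (D * \<rho> m powr dw * K) + 2 * T m k))"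
    proof -
      have "2 * ennreal x + 2 * ennreal y = ennreal (2 * x + 2 * y)" if "x \<ge> 0" "y \<ge> 0" for x y
        using that by (simp add: ennreal_mult)
      then show ?thesis
        using D K(1) T_nonneg by (simp only: add_nonneg_nonneg mult_nonneg_nonneg powr_ge_zero less_imp_le zero_le_numeral)
    qed
    also have "2 * (2 * (D * \<rho> m powr dw * K) + 2 * T m n) + 2 * (2 * (D * \<rho> m powr dw * K) + 2 * T m k)
        = 8 * D * K * \<rho> m powr dw + 4 * T m n + 4 * T m k"
      by (simp add: algebra_simps)
    finally show ?thesis .
  qed

  have Cauchy: "\<exists>N. \<forall>n\<ge>N. \<forall>k\<ge>N. (\<integral>\<^sup>+y. ennreal ((f (\<phi> n) y - f (\<phi> k) y)\<^sup>2) \<partial>M) \<le> ennreal \<epsilon>"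
    if "\<epsilon> > 0" for \<epsilon>
  proof -
    have "(\<lambda>m. \<rho> m powr dw) \<longlonglongrightarrow> 0"
      using assms(1) unfolding \<rho>_def
      by (intro tendsto_zero_powrI[OF LIMSEQ_inverse_real_of_nat tendsto_const]) auto
    then have "(\<lambda>m. 8 * D * K * \<rho> m powr dw) \<longlonglongrightarrow> 0"
      by (rule tendsto_mult_right_zero)
    then have "\<forall>\<^sub>F m in sequentially. 8 * D * K * \<rho> m powr dw < \<epsilon> / 2"
      using that by (intro order_tendstoD) auto
    \<comment> \<open>The scale is fixed first, independently of \<open>n\<close> and
      \<open>k\<close>; only then is \<open>N\<close> chosen for that scale. The budget is
      \<epsilon>/2 + 4(\<epsilon>/16) + 4(\<epsilon>/16) = \<epsilon>.\<close>
    then obtain m where m: "8 * D * K * \<rho> m powr dw < \<epsilon> / 2"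
      by (auto simp: eventually_sequentially)
    have "\<forall>\<^sub>F n in sequentially. T m n < \<epsilon> / 16"
      using that by (intro order_tendstoD(2)[OF T]) auto
    then obtain N where N: "\<And>n. n \<ge> N \<Longrightarrow> T m n < \<epsilon> / 16"
      by (auto simp: eventually_sequentially)
    have "(\<integral>\<^sup>+y. ennreal ((f (\<phi> n) y - f (\<phi> k) y)\<^sup>2) \<partial>M) \<le> ennreal \<epsilon>" if "n \<ge> N" "k \<ge> N" for n k
      using m N[OF that(1)] N[OF that(2)] \<open>\<epsilon> > 0\<close>
      by (intro order_trans[OF diff[of n k m]] ennreal_leI) linarith
    then show ?thesis by blast
  qed
  obtain g where "g \<in> L2_space M" "(\<lambda>k. L2_norm M (\<lambda>x. f (\<phi> k) x - g x)) \<longlonglongrightarrow> 0"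
    by (rule L2_complete[of "\<lambda>n. f (\<phi> n)" M, OF f_L2 Cauchy])
  with \<phi>(1) show ?thesis by blast
qed

end
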